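(* Let $0<\theta_1^\ast<\theta_2^\ast<\pi$, let $B_1,B_2,\Gamma_1,\Gamma_2$ be the discs and arcs determined by these angles as described in the context, and let $N\ge 4$ be an integer. Set $$r_N^\ast:=\left(1-2\,\frac{\ln(2(N+1))}{N+1}\right)^{1/2},\qquad \Gamma_2^{(N)}:=\{x\in\Gamma_2 : |x|\le r_N^\ast\}.$$ Then $$\max_{v\in C(\overline{\Gamma}_1),\,v\ne0}\ \frac{\big\|\big(\Delta_1^{-1}P_N^1(0,v)\big)|_{\Gamma_2^{(N)}}\big\|_{L^\infty(\Gamma_2^{(N)})}}{\|v\|_{L^\infty(\overline{\Gamma}_1)}}\;\le\;\frac{\theta_2^\ast-\theta_1^\ast}{\pi}+\epsilon(r_N^\ast),\qquad \epsilon(r_N^\ast):=\frac{2}{\pi}\int_0^{r_N^\ast}\frac{s^N}{1-s}\,ds.$$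
   Context: Geometry: $B_1$ is the open unit disc in $\mathbb R^2$ centred at the origin and $B_2$ is the open disc with centre $(m,0)$ and radius $R$, where $$R=\frac{\sin\theta_1^\ast}{\sin\theta_2^\ast},\qquad m=\cos\theta_1^\ast-\frac{\sin\theta_1^\ast}{\tan\theta_2^\ast}\ \text{ if }\theta_2^\ast\ne\tfrac{\pi}{2},\qquad m=\cos\theta_1^\ast\ \text{ if }\theta_2^\ast=\tfrac{\pi}{2}.$$ Then $m>0$ and the two circles intersect exactly in the two points $(\cos\theta_1^\ast,\pm\sin\theta_1^\ast)=(m,0)+R(\cos\theta_2^\ast,\pm\sin\theta_2^\ast)$. Put $\Gamma_1:=\partial B_1\cap B_2$ (the arc of the unit circle with polar angle in $(-\theta_1^\ast,\theta_1^\ast)$) and $\Gamma_2:=\partial B_2\cap B_1$. For $v\in C(\overline\Gamma_1)$, $(0,v)$ denotes the function on $\partial B_1$ equal to $v$ on $\Gamma_1$ and $0$ on $\partial B_1\setminus\Gamma_1$ (piecewise continuous; its values at the two endpoints of $\Gamma_1$ are irrelevant). $\partial B_1$ is parametrized by the polar angle $\theta$; $P_N^1$ is the $L^2(\partial B_1)$-orthogonal projection onto $\mathrm{span}\{1,\cos(n\theta),\sin(n\theta): 1\le n\le N\}$. $\Delta_1^{-1}$ is harmonic extension to $B_1$: in polar coordinates, $(\Delta_1^{-1}h)(\theta,r)=\frac1{2\pi}\int_0^{2\pi}\frac{1-r^2}{1-2r\cos(\theta-\theta')+r^2}\,h(\theta')\,d\theta'$ for $0\le r<1$; thus for $h=\alpha_0+\sum_{n=1}^N(\alpha_n\cos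 n\theta+\beta_n\sin n\theta)$ it is $\alpha_0+\sum_{n=1}^N r^n(\alpha_n\cos n\theta+\beta_n\sin n\theta)$. $L^\infty$ norms are supremum norms (of continuous functions); the supremum over an empty set $\Gamma_2^{(N)}$ is taken to be $0$. *)

theory Defs
  imports "HOL-Analysis.Analysis"
begin

text \<open>
  The plane is identified with the type \<^typ>\<open>complex\<close>, so that the point of the unit circle with
  polar angle \<open>t\<close> is \<open>cis t\<close>. Functions on \<open>\<partial>B\<^sub>1\<close> that are projected or extended
  harmonically are given as functions of the polar angle, and \<open>L\<^sup>2(\<partial>B\<^sub>1)\<close> carries the
  arc length measure \<open>dt\<close> on \<open>[0, 2\<pi>]\<close>.
\<close>

definition radius2 :: "real \<Rightarrow> real \<Rightarrow> real" where
  "radius2 \<theta>1 \<theta>2 = sin \<theta>1 / sin \<theta>2"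

definition centre2 :: "real \<Rightarrow> real \<Rightarrow> real" where
  "centre2 \<theta>1 \<theta>2 = (if \<theta>2 = pi / 2 then cos \<theta>1 else cos \<theta>1 - sin \<theta>1 / tan \<theta>2)"

definition B1 :: "complex set" where
  "B1 = ball 0 1"

definition B2 :: "real \<Rightarrow> real \<Rightarrow> complex set" where
  "B2 \<theta>1 \<theta>2 = ball (Complex (centre2 \<theta>1 \<theta>2) 0) (radius2 \<theta>1 \<theta>2)"

definition Gamma1 :: "real \<Rightarrow> real \<Rightarrow> complex set" where
  "Gamma1 \<theta>1 \<theta>2 = frontier B1 \<inter> B2 \<theta>1 \<theta>2"

definition Gamma2 :: "real \<Rightarrow> real \<Rightarrow> complex set" where
  "Gamma2 \<theta>1 \<theta>2 = frontier (B2 \<theta>1 \<theta>2) \<inter> B1"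

definition zero_ext :: "complex set \<Rightarrow> (complex \<Rightarrow> real) \<Rightarrow> real \<Rightarrow> real" where
  "zero_ext \<Gamma> v t = (if cis t \<in> \<Gamma> then v (cis t) else 0)"

definition trig_polys :: "nat \<Rightarrow> (real \<Rightarrow> real) set" where
  "trig_polys N =
     {(\<lambda>t. a 0 + (\<Sum>n=1..N. a n * cos (real n * t) + b n * sin (real n * t))) | a b. True}"

text \<open>
  For \<open>h\<close> square integrable on \<open>[0, 2\<pi>]\<close> the described \<open>p\<close> exists and is unique, also as
  a function on all of \<open>\<real>\<close>: elements of \<open>trig_polys N\<close> are continuous and \<open>2\<pi>\<close>-periodic.
\<close>
definition L2_proj :: "nat \<Rightarrow> (real \<Rightarrow> real) \<Rightarrow> real \<Rightarrow> real" where
  "L2_proj N h = (THE p. p \<in> trig_polys N \<and>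
     (\<forall>q\<in>trig_polys N. integral {0..2*pi} (\<lambda>t. (h t - p t) * q t) = 0))"

definition harmonic_ext :: "(real \<Rightarrow> real) \<Rightarrow> complex \<Rightarrow> real" where
  "harmonic_ext h z = 1 / (2*pi) * integral {0..2*pi}
     (\<lambda>t. (1 - cmod z ^ 2) / (1 - 2 * cmod z * cos (Arg z - t) + cmod z ^ 2) * h t)"

text \<open>
  Supremum norm on \<open>S\<close>, used only for functions bounded on \<open>S\<close>. The supremum of the empty
  set of reals is unspecified in the library, hence the case distinction.
\<close>
definition sup_norm :: "complex set \<Rightarrow> (complex \<Rightarrow> real) \<Rightarrow> real" where
  "sup_norm S f = (if S = {} then 0 else (SUP x\<in>S. \<bar>f x\<bar>))"

definition r_star :: "nat \<Rightarrow> real" where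
  "r_star N = sqrt (1 - 2 * (ln (2 * (real N + 1)) / (real N + 1)))"

definition Gamma2_trunc :: "real \<Rightarrow> real \<Rightarrow> nat \<Rightarrow> complex set" where
  "Gamma2_trunc \<theta>1 \<theta>2 N = {x \<in> Gamma2 \<theta>1 \<theta>2. cmod x \<le> r_star N}"

definition eps :: "nat \<Rightarrow> real \<Rightarrow> real" where
  "eps N r = 2 / pi * integral {0..r} (\<lambda>s. s ^ N / (1 - s))"

text \<open>
  The nonzero elements of \<open>C(closure \<Gamma>\<^sub>1)\<close>; the values of \<open>v\<close> off \<open>closure \<Gamma>\<^sub>1\<close> play no role.
\<close>
definition nonzero_cont :: "real \<Rightarrow> real \<Rightarrow> (complex \<Rightarrow> real) set" where
  "nonzero_cont \<theta>1 \<theta>2 = {v. continuous_on (closure (Gamma1 \<theta>1 \<theta>2)) v \<and>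
     (\<exists>x\<in>closure (Gamma1 \<theta>1 \<theta>2). v x \<noteq> 0)}"

definition ratio :: "real \<Rightarrow> real \<Rightarrow> nat \<Rightarrow> (complex \<Rightarrow> real) \<Rightarrow> real" where
  "ratio \<theta>1 \<theta>2 N v =
     sup_norm (Gamma2_trunc \<theta>1 \<theta>2 N)
       (harmonic_ext (L2_proj N (zero_ext (Gamma1 \<theta>1 \<theta>2) v)))
     / sup_norm (closure (Gamma1 \<theta>1 \<theta>2)) v"

end

theory Submission
  imports Defs
begin

text \<open>
  The operator \<open>h \<mapsto> \<Delta>\<^sub>1\<^sup>-\<^sup>1 P\<^sub>N h\<close> has the truncated Poisson kernel
  \<open>1 + 2 \<Sum>\<^sub>n\<^sub>\<le>\<^sub>N r\<^sup>n cos (n \<phi>)\<close>, whose product with \<open>1 - 2 r cos \<phi> + r\<^sup>2\<close> is at least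
  \<open>(1 + r) (1 - r - 2 r\<^sup>N\<^sup>+\<^sup>1)\<close>; the radius \<open>r\<^sub>N\<^sup>*\<close> is small enough to make this nonnegative. Hence
  \<open>v = 1\<close> maximizes the ratio. For \<open>v = 1\<close> the extension at \<open>z\<close> equals
  \<open>\<theta>\<^sub>1 / \<pi> + Im (F (z cis \<theta>\<^sub>1) - F (z cis (- \<theta>\<^sub>1))) / \<pi>\<close> with \<open>F w = \<Sum>\<^sub>n\<^sub>\<le>\<^sub>N w\<^sup>n / n\<close>.
  Replacing \<open>F w\<close> by \<open>- Ln (1 - w)\<close> costs \<open>\<epsilon>\<close> in total and turns the expression into the harmonic
  measure of \<open>\<Gamma>\<^sub>1\<close>, which by the inscribed angle theorem is \<open>(\<theta>\<^sub>2 - \<theta>\<^sub>1) / \<pi>\<close> on all of \<open>\<Gamma>\<^sub>2\<close>.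
\<close>

subsection \<open>Trigonometric polynomials and the projection\<close>

text \<open>The phase \<open>a\<close> treats cosine (\<open>a = 0\<close>) and sine
  (\<open>a = pi/2\<close>) at once. The frequency is an integer because differences
  \<open>n - m\<close> are substituted for it.\<close>

lemma has_integral_cos_int:
  fixes k :: int
  shows "((\<lambda>t. cos (a - of_int k * t)) has_integral (if k = 0 then 2 * pi * cos a else 0)) {0..2*pi}"
proof (cases "k = 0")
  case True
  then show ?thesis
    using has_integral_const_real[of "cos a" 0 "2*pi"] by simp
next
  case False
  have "((\<lambda>t. cos (a - of_int k * t)) has_integral
      - sin (a - of_int k * (2*pi)) / of_int k - - sin (a - of_int k * 0) / of_int k) {0..2*pi}"
    using False
    by (intro fundamental_theorem_of_calculus)
       (auto intro!: derivative_eq_intros simp flip: has_real_derivative_iff_has_vector_derivative)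
  moreover have "sin (a - of_int k * (2*pi)) = sin a"
    using sin_int_2pin[of k] cos_int_2pin[of k] by (simp add: sin_diff mult.commute)
  ultimately show ?thesis using False by simp
qed

lemma has_integral_cos_cos:
  "((\<lambda>t. cos (b - real n * t) * cos (a - real m * t)) has_integral
     (if n = m then if m = 0 then 2 * pi * (cos a * cos b) else pi * cos (b - a) else 0)) {0..2*pi}"
proof -
  have eq: "cos (b - real n * t) * cos (a - real m * t) =
      (cos ((b - a) - of_int (int n - int m) * t) + cos ((b + a) - of_int (int n + int m) * t)) / 2" for t
    unfolding cos_times_cos by (simp add: algebra_simps)
  have "((\<lambda>t. cos (b - real n * t) * cos (a - real m * t)) has_integral
      ((if int n - int m = 0 then 2 * pi * cos (b - a) else 0) +
       (if int n + int m = 0 then 2 * pi * cos (b + a) else 0)) / 2) {0..2*pi}"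
    unfolding eq by (intro has_integral_divide has_integral_add has_integral_cos_int)
  moreover have "((if int n - int m = 0 then 2 * pi * cos (b - a) else 0) +
       (if int n + int m = 0 then 2 * pi * cos (b + a) else 0)) / 2 =
     (if n = m then if m = 0 then 2 * pi * (cos a * cos b) else pi * cos (b - a) else 0)"
    by (auto simp: cos_add cos_diff algebra_simps)
  ultimately show ?thesis by simp
qed

definition trig_poly :: "nat \<Rightarrow> (nat \<Rightarrow> real) \<Rightarrow> (nat \<Rightarrow> real) \<Rightarrow> real \<Rightarrow> real" where
  "trig_poly N a b t = a 0 + (\<Sum>n=1..N. a n * cos (real n * t) + b n * sin (real n * t))"

lemma trig_polys_eq: "trig_polys N = {trig_poly N a b | a b. True}"
  by (simp add: trig_polys_def trig_poly_def[abs_def])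

text \<open>By linearity, moments against shifted cosines suffice: phase \<open>0\<close> yields the
  cosine terms, phase \<open>pi/2\<close> the sine terms. The weight \<open>f\<close> will be a
  cosine, the projection error, the Poisson kernel, and the data \<open>h\<close>.\<close>

lemma has_integral_mult_trig_poly:
  assumes "\<And>\<alpha> m. m \<le> N \<Longrightarrow> ((\<lambda>t. f t * cos (\<alpha> - real m * t)) has_integral I \<alpha> m) S"
  shows "((\<lambda>t. f t * trig_poly N a b t) has_integral
     a 0 * I 0 0 + (\<Sum>n=1..N. a n * I 0 n + b n * I (pi/2) n)) S"
proof -
  have eq: "f t * trig_poly N a b t = a 0 * (f t * cos (0 - real 0 * t)) +
      (\<Sum>n=1..N. a n * (f t * cos (0 - real n * t)) + b n * (f t * cos (pi/2 - real n * t)))" for t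
    by (simp add: trig_poly_def cos_diff algebra_simps sum_distrib_left)
  show ?thesis
    unfolding eq
    by (intro has_integral_add has_integral_sum has_integral_mult_right assms) auto
qed

lemma has_integral_cos_trig_poly:
  assumes "m \<le> N"
  shows "((\<lambda>t. trig_poly N a b t * cos (\<alpha> - real m * t)) has_integral
     (if m = 0 then 2 * pi * (a 0 * cos \<alpha>) else pi * (a m * cos \<alpha> + b m * sin \<alpha>))) {0..2*pi}"
    (is "(_ has_integral ?R) _")
proof -
  define J where "J \<beta> n = (if n = m then if m = 0 then 2 * pi * (cos \<beta> * cos \<alpha>)
    else pi * cos (\<alpha> - \<beta>) else 0)" for \<beta> and n :: nat
  have "((\<lambda>t. cos (\<alpha> - real m * t) * trig_poly N a b t) has_integral
     a 0 * J 0 0 + (\<Sum>n=1..N. a n * J 0 n + b n * J (pi/2) n)) {0..2*pi}"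
  proof (rule has_integral_mult_trig_poly)
    fix \<beta> n
    show "((\<lambda>t. cos (\<alpha> - real m * t) * cos (\<beta> - real n * t)) has_integral J \<beta> n) {0..2*pi}"
      using has_integral_cos_cos[of \<alpha> m \<beta> n] unfolding J_def by (cases "m = n") auto
  qed
  moreover have "a 0 * J 0 0 + (\<Sum>n=1..N. a n * J 0 n + b n * J (pi/2) n) = ?R"
  proof (cases "m = 0")
    case True
    then have "(\<Sum>n=1..N. a n * J 0 n + b n * J (pi/2) n) = 0"
      by (intro sum.neutral) (auto simp: J_def)
    then show ?thesis using True by (simp add: J_def)
  next
    case False
    have "(\<Sum>n=1..N. a n * J 0 n + b n * J (pi/2) n) =
        (\<Sum>n=1..N. if n = m then pi * (a m * cos \<alpha> + b m * sin \<alpha>) else 0)"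
      using False by (intro sum.cong) (auto simp: J_def cos_diff algebra_simps)
    also have "\<dots> = pi * (a m * cos \<alpha> + b m * sin \<alpha>)"
      using False assms by (subst sum.delta) auto
    finally show ?thesis using False by (simp add: J_def)
  qed
  ultimately show ?thesis by (simp add: mult.commute)
qed

definition fourier_cos :: "(real \<Rightarrow> real) \<Rightarrow> nat \<Rightarrow> real" where
  "fourier_cos h n = integral {0..2*pi} (\<lambda>t. h t * cos (real n * t)) / (if n = 0 then 2 * pi else pi)"

definition fourier_sin :: "(real \<Rightarrow> real) \<Rightarrow> nat \<Rightarrow> real" where
  "fourier_sin h n = integral {0..2*pi} (\<lambda>t. h t * sin (real n * t)) / pi"

text \<open>Subtracting the Fourier partial sum cancels every moment of order at most
  \<open>N\<close>, so the error is orthogonal to \<open>trig_polys N\<close>. Conversely, testing a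
  candidate with single cosines and sines determines its coefficients, which gives the uniqueness
  demanded by \<open>THE\<close>.\<close>

lemma L2_proj_eq_trig_poly:
  assumes int: "\<And>\<alpha> m. (\<lambda>t. h t * cos (\<alpha> - real m * t)) integrable_on {0..2*pi}"
  shows "L2_proj N h = trig_poly N (fourier_cos h) (fourier_sin h)"
proof -
  define I where "I = (\<lambda>\<alpha> m. integral {0..2*pi} (\<lambda>t. h t * cos (\<alpha> - real m * t)))"
  have I: "((\<lambda>t. h t * cos (\<alpha> - real m * t)) has_integral I \<alpha> m) {0..2*pi}" for \<alpha> m
    using int unfolding I_def by (rule integrable_integral)
  have I_cos: "I 0 m = integral {0..2*pi} (\<lambda>t. h t * cos (real m * t))" for m
    by (simp add: I_def)
  have I_sin: "I (pi/2) m = integral {0..2*pi} (\<lambda>t. h t * sin (real m * t))" for m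
    by (simp add: I_def cos_diff)
  have I_eq: "I \<alpha> m = cos \<alpha> * I 0 m + sin \<alpha> * I (pi/2) m" for \<alpha> m
  proof -
    have "((\<lambda>t. cos \<alpha> * (h t * cos (0 - real m * t)) + sin \<alpha> * (h t * cos (pi/2 - real m * t)))
        has_integral cos \<alpha> * I 0 m + sin \<alpha> * I (pi/2) m) {0..2*pi}"
      by (intro has_integral_add has_integral_mult_right I)
    then show ?thesis
      by (intro has_integral_unique[OF I]) (simp add: cos_diff algebra_simps)
  qed
  have diff: "((\<lambda>t. (h t - trig_poly N a b t) * cos (\<alpha> - real m * t)) has_integral
      I \<alpha> m - (if m = 0 then 2 * pi * (a 0 * cos \<alpha>) else pi * (a m * cos \<alpha> + b m * sin \<alpha>))) {0..2*pi}"
    if "m \<le> N" for a b \<alpha> m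
    unfolding left_diff_distrib by (intro has_integral_diff I has_integral_cos_trig_poly that)
  let ?p = "trig_poly N (fourier_cos h) (fourier_sin h)"
  show ?thesis
    unfolding L2_proj_def
  proof (rule the_equality, intro conjI ballI)
    show "?p \<in> trig_polys N" by (auto simp: trig_polys_eq)
  next
    fix q assume "q \<in> trig_polys N"
    then obtain c d where q: "q = trig_poly N c d" by (auto simp: trig_polys_eq)
    have "((\<lambda>t. (h t - ?p t) * cos (\<alpha> - real m * t)) has_integral 0) {0..2*pi}" if "m \<le> N" for \<alpha> m
    proof -
      have "I \<alpha> m - (if m = 0 then 2 * pi * (fourier_cos h 0 * cos \<alpha>)
          else pi * (fourier_cos h m * cos \<alpha> + fourier_sin h m * sin \<alpha>)) = 0"
        unfolding I_eq[of \<alpha>] by (auto simp: I_cos I_sin fourier_cos_def fourier_sin_def algebra_simps)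
      then show ?thesis using diff[OF that, of "fourier_cos h" "fourier_sin h" \<alpha>] by simp
    qed
    from has_integral_mult_trig_poly[OF this, of N c d]
    show "integral {0..2*pi} (\<lambda>t. (h t - ?p t) * q t) = 0"
      unfolding q by (intro integral_unique) simp
  next
    fix p assume p: "p \<in> trig_polys N \<and> (\<forall>q\<in>trig_polys N. integral {0..2*pi} (\<lambda>t. (h t - p t) * q t) = 0)"
    then obtain a b where ab: "p = trig_poly N a b" by (auto simp: trig_polys_eq)
    have cos_in: "(\<lambda>t. cos (real m * t)) \<in> trig_polys N" if "m \<le> N" for m
    proof -
      have "(\<lambda>t. cos (real m * t)) = trig_poly N (\<lambda>n. if n = m then 1 else 0) (\<lambda>n. 0)"
        using that by (cases "m = 0") (auto simp: trig_poly_def if_distrib[where f="\<lambda>x. x * _"] sum.delta cong: if_cong)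
      then show ?thesis by (auto simp: trig_polys_eq)
    qed
    have sin_in: "(\<lambda>t. sin (real m * t)) \<in> trig_polys N" if "m \<le> N" for m
    proof -
      have "(\<lambda>t. sin (real m * t)) = trig_poly N (\<lambda>n. 0) (\<lambda>n. if n = m then 1 else 0)"
        using that by (cases "m = 0") (auto simp: trig_poly_def if_distrib[where f="\<lambda>x. x * _"] sum.delta cong: if_cong)
      then show ?thesis by (auto simp: trig_polys_eq)
    qed
    have a: "a m = fourier_cos h m" if "m \<le> N" for m
    proof -
      have "integral {0..2*pi} (\<lambda>t. (h t - p t) * cos (real m * t)) = 0"
        using bspec[OF conjunct2[OF p] cos_in[OF that]] by simp
      then show ?thesis
        using integral_unique[OF diff[OF that, of a b 0]] unfolding ab
        by (auto simp: I_cos fourier_cos_def field_simps split: if_splits)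
    qed
    \<comment> \<open>The coefficient \<open>b 0\<close> multiplies \<open>sin 0\<close> and cannot
      be recovered, so the comparison starts at 1, as the sum in \<open>trig_poly\<close>
      does.\<close>
    have b: "b m = fourier_sin h m" if "m \<le> N" "m \<ge> 1" for m
    proof -
      have "integral {0..2*pi} (\<lambda>t. (h t - p t) * sin (real m * t)) = 0"
        using bspec[OF conjunct2[OF p] sin_in[OF that(1)]] by simp
      moreover have "cos (pi/2 - real m * t) = sin (real m * t)" for t
        by (simp add: cos_diff)
      ultimately have "pi * b m = I (pi/2) m"
        using integral_unique[OF diff[OF that(1), of a b "pi/2"]] that unfolding ab by simp
      then show ?thesis by (simp add: I_sin fourier_sin_def field_simps)
    qed
    show "p = ?p"
      unfolding ab by (auto simp: trig_poly_def fun_eq_iff a b intro!: sum.cong)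
  qed
qed

subsection \<open>The truncated Poisson kernel\<close>

definition poisson_sum :: "nat \<Rightarrow> real \<Rightarrow> real \<Rightarrow> real" where
  "poisson_sum N r \<phi> = 1 + 2 * (\<Sum>n=1..N. r ^ n * cos (real n * \<phi>))"

lemma poisson_sum_eq_trig_poly:
  "poisson_sum N r (\<beta> - t) = trig_poly N (\<lambda>n. if n = 0 then 1 else 2 * r ^ n * cos (real n * \<beta>))
     (\<lambda>n. 2 * r ^ n * sin (real n * \<beta>)) t"
  by (simp add: poisson_sum_def trig_poly_def cos_diff algebra_simps sum_distrib_left sum.distrib)

text \<open>The right-hand side is the squared distance from 1 to the point with polar coordinates
  \<open>r\<close>, \<open>\<phi>\<close>.\<close>

lemma poisson_denominator_ge:
  fixes r :: real
  assumes "0 \<le> r"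
  shows "(1 - r)\<^sup>2 \<le> 1 - 2 * r * cos \<phi> + r\<^sup>2"
proof -
  have "r * cos \<phi> \<le> r * 1" using assms by (intro mult_left_mono) auto
  then show ?thesis by (simp add: power2_eq_square algebra_simps)
qed

text \<open>A geometric sum in real form: the recurrence \<open>c\<close> for cosines makes
  everything telescope except two boundary terms. These two terms control both the sign of the
  truncated kernel and its distance to the Poisson kernel.\<close>

lemma poisson_sum_closed_form:
  "(1 - 2 * r * cos \<phi> + r\<^sup>2) * poisson_sum N r \<phi> =
     1 - r\<^sup>2 - 2 * r ^ (N + 1) * cos (real (N + 1) * \<phi>) + 2 * r ^ (N + 2) * cos (real N * \<phi>)"
proof (induction N)
  case 0
  show ?case by (simp add: poisson_sum_def power2_eq_square)
next
  case (Suc N)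
  have step: "poisson_sum (Suc N) r \<phi> = poisson_sum N r \<phi> + 2 * r ^ (N + 1) * cos (real (N + 1) * \<phi>)"
    by (simp add: poisson_sum_def)
  have c: "2 * cos \<phi> * cos (real (N + 1) * \<phi>) = cos (real (N + 2) * \<phi>) + cos (real N * \<phi>)"
  proof -
    have "real (N + 2) * \<phi> = real (N + 1) * \<phi> + \<phi>" "real N * \<phi> = real (N + 1) * \<phi> - \<phi>"
      by (simp_all add: algebra_simps)
    then show ?thesis by (simp only: cos_add cos_diff) simp
  qed
  have "(1 - 2 * r * cos \<phi> + r\<^sup>2) * poisson_sum (Suc N) r \<phi> =
      (1 - 2 * r * cos \<phi> + r\<^sup>2) * poisson_sum N r \<phi>
      + (1 + r\<^sup>2) * (2 * r ^ (N + 1) * cos (real (N + 1) * \<phi>))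
      - 2 * r ^ (N + 2) * (2 * cos \<phi> * cos (real (N + 1) * \<phi>))"
    unfolding step by (simp add: algebra_simps)
  also have "\<dots> = 1 - r\<^sup>2 - 2 * r ^ (N + 2) * cos (real (N + 2) * \<phi>) + 2 * r ^ (N + 3) * cos (real (N + 1) * \<phi>)"
    unfolding Suc.IH c by (simp add: algebra_simps power2_eq_square power_add power3_eq_cube)
  finally show ?case by (simp add: numeral_eq_Suc)
qed

lemma poisson_sum_nonneg:
  assumes r: "0 \<le> r" "2 * r ^ (N + 1) \<le> 1 - r" "r < 1"
  shows "0 \<le> poisson_sum N r \<phi>"
proof -
  have "r ^ (N + 1) * cos (real (N + 1) * \<phi>) \<le> r ^ (N + 1) * 1"
    using r(1) by (intro mult_left_mono) auto
  moreover have "r ^ (N + 2) * (-1) \<le> r ^ (N + 2) * cos (real N * \<phi>)"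
    using r(1) by (intro mult_left_mono) auto
  \<comment> \<open>This product is what the closed form leaves when the first cosine is replaced by
    1 and the second by -1.\<close>
  moreover have "0 \<le> (1 + r) * (1 - r - 2 * r ^ (N + 1))" using r by simp
  ultimately have "0 \<le> (1 - 2 * r * cos \<phi> + r\<^sup>2) * poisson_sum N r \<phi>"
    unfolding poisson_sum_closed_form by (simp add: algebra_simps power2_eq_square)
  moreover have "0 < 1 - 2 * r * cos \<phi> + r\<^sup>2"
    using r by (intro less_le_trans[OF _ poisson_denominator_ge]) auto
  ultimately show ?thesis by (simp add: zero_le_mult_iff)
qed

lemma continuous_on_poisson_kernel:
  fixes r :: real
  assumes "0 \<le> r" "r < 1"
  shows "continuous_on S (\<lambda>t. (1 - r\<^sup>2) / (1 - 2 * r * cos (\<beta> - t) + r\<^sup>2))"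
proof (intro continuous_intros ballI)
  fix t
  have "0 < (1 - r)\<^sup>2" using assms by simp
  then show "1 - 2 * r * cos (\<beta> - t) + r\<^sup>2 \<noteq> 0" using poisson_denominator_ge[OF assms(1), of "\<beta> - t"] by linarith
qed

lemma has_integral_poisson_sum_cos:
  assumes "m \<le> M"
  shows "((\<lambda>t. poisson_sum M r (\<beta> - t) * cos (\<alpha> - real m * t)) has_integral
    2 * pi * (r ^ m * cos (real m * \<beta> - \<alpha>))) {0..2*pi}"
proof -
  show ?thesis
    unfolding poisson_sum_eq_trig_poly
    using has_integral_cos_trig_poly[OF assms, of "\<lambda>n. if n = 0 then 1 else 2 * r ^ n * cos (real n * \<beta>)"
        "\<lambda>n. 2 * r ^ n * sin (real n * \<beta>)" \<alpha>]
    by (cases "m = 0") (simp_all add: cos_diff algebra_simps)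
qed

text \<open>The two boundary terms of the closed form are each at most \<open>2 * r ^ M\<close>. The
  bound is crude, but uniform in \<open>\<phi>\<close> and vanishing as \<open>M\<close>
  grows.\<close>

lemma poisson_sum_approx:
  assumes r: "0 \<le> r" "r < 1"
  shows "\<bar>(1 - r\<^sup>2) / (1 - 2 * r * cos \<phi> + r\<^sup>2) - poisson_sum M r \<phi>\<bar> \<le> 4 * r ^ M / (1 - r)\<^sup>2"
proof -
  let ?d = "1 - 2 * r * cos \<phi> + r\<^sup>2"
  have d0: "0 < (1 - r)\<^sup>2" using r by simp
  then have d: "0 < ?d" using poisson_denominator_ge[OF r(1), of \<phi>] by linarith
  have "(1 - r\<^sup>2) / ?d - poisson_sum M r \<phi> =
      (2 * r ^ (M + 1) * cos (real (M + 1) * \<phi>) - 2 * r ^ (M + 2) * cos (real M * \<phi>)) / ?d"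
    using poisson_sum_closed_form[of r \<phi> M] d by (simp add: field_simps)
  moreover have "\<bar>2 * r ^ (M + 1) * cos (real (M + 1) * \<phi>) - 2 * r ^ (M + 2) * cos (real M * \<phi>)\<bar> \<le> 4 * r ^ M"
  proof -
    have *: "\<bar>r ^ (M + k) * cos x\<bar> \<le> r ^ M" for k x
    proof -
      have "\<bar>r ^ (M + k)\<bar> \<le> r ^ M" using r by (simp add: power_decreasing)
      then have "\<bar>r ^ (M + k)\<bar> * \<bar>cos x\<bar> \<le> r ^ M * 1" using r by (intro mult_mono) auto
      then show ?thesis by (simp add: abs_mult)
    qed
    show ?thesis
      using *[of 1 "real (M + 1) * \<phi>"] *[of 2 "real M * \<phi>"] unfolding abs_le_iff mult.assoc by linarith
  qed
  ultimately show ?thesis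
    using d d0 poisson_denominator_ge[OF r(1), of \<phi>] r
    by (simp only: abs_divide) (intro frac_le, auto)
qed

text \<open>The truncated kernels reproduce \<open>r\<^sup>m cos (m \<beta> - \<alpha>)\<close> exactly once \<open>M \<ge> m\<close>, and they converge
  uniformly to the Poisson kernel.\<close>
lemma has_integral_poisson_kernel_cos:
  assumes r: "0 \<le> r" "r < 1"
  shows "((\<lambda>t. (1 - r\<^sup>2) / (1 - 2 * r * cos (\<beta> - t) + r\<^sup>2) * cos (\<alpha> - real m * t)) has_integral
    2 * pi * (r ^ m * cos (real m * \<beta> - \<alpha>))) {0..2*pi}"
proof -
  let ?P = "\<lambda>t. (1 - r\<^sup>2) / (1 - 2 * r * cos (\<beta> - t) + r\<^sup>2)"
  have int: "(\<lambda>t. ?P t * cos (\<alpha> - real m * t)) integrable_on {0..2*pi}"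
    by (intro integrable_continuous_interval continuous_on_mult continuous_on_poisson_kernel r continuous_intros)
  define I where "I = integral {0..2*pi} (\<lambda>t. ?P t * cos (\<alpha> - real m * t))"
  define J where "J = 2 * pi * (r ^ m * cos (real m * \<beta> - \<alpha>))"
  \<comment> \<open>Neither \<open>I\<close> nor \<open>J\<close> depends on \<open>M\<close>, so a
    bound tending to 0 forces equality.\<close>
  have bound: "\<bar>I - J\<bar> \<le> 4 * r ^ M / (1 - r)\<^sup>2 * (2 * pi)" if "m \<le> M" for M
  proof -
    have "((\<lambda>t. ?P t * cos (\<alpha> - real m * t) - poisson_sum M r (\<beta> - t) * cos (\<alpha> - real m * t))
        has_integral I - J) {0..2*pi}"
      unfolding J_def I_def
      by (intro has_integral_diff has_integral_poisson_sum_cos that integrable_integral int)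
    then have "((\<lambda>t. (?P t - poisson_sum M r (\<beta> - t)) * cos (\<alpha> - real m * t))
        has_integral I - J) {0..2*pi}"
      by (simp add: left_diff_distrib)
    then have "norm (I - J) \<le> 4 * r ^ M / (1 - r)\<^sup>2 * measure lborel {0..2*pi}"
    proof (rule has_integral_bound_real[where S="{}", rotated 2])
      fix t
      have "\<bar>?P t - poisson_sum M r (\<beta> - t)\<bar> * \<bar>cos (\<alpha> - real m * t)\<bar> \<le> 4 * r ^ M / (1 - r)\<^sup>2 * 1"
        using r by (intro mult_mono poisson_sum_approx) auto
      then show "norm ((?P t - poisson_sum M r (\<beta> - t)) * cos (\<alpha> - real m * t)) \<le> 4 * r ^ M / (1 - r)\<^sup>2"
        by (simp add: abs_mult)
    qed (use r in auto)
    then show ?thesis by simp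
  qed
  have "(\<lambda>M. r ^ M) \<longlonglongrightarrow> 0" using r by (intro LIMSEQ_power_zero) auto
  then have "(\<lambda>M. 4 * r ^ M / (1 - r)\<^sup>2 * (2 * pi)) \<longlonglongrightarrow> 4 * 0 / (1 - r)\<^sup>2 * (2 * pi)"
    using r by (intro tendsto_intros) auto
  from LIMSEQ_le_const[OF this] bound have "\<bar>I - J\<bar> \<le> 4 * 0 / (1 - r)\<^sup>2 * (2 * pi)" by blast
  then have "I = J" by simp
  with integrable_integral[OF int] show ?thesis by (simp add: I_def J_def)
qed

section \<open>The projected and extended data as one integral\<close>

text \<open>Passes from the Poisson integral to the multiplier form, in which mode \<open>n\<close>
  is damped by \<open>cmod z ^ n\<close>.\<close>

lemma harmonic_ext_trig_poly:
  assumes "cmod z < 1"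
  shows "harmonic_ext (trig_poly N a b) z =
    trig_poly N (\<lambda>n. cmod z ^ n * a n) (\<lambda>n. cmod z ^ n * b n) (Arg z)"
proof -
  have "((\<lambda>t. (1 - cmod z ^ 2) / (1 - 2 * cmod z * cos (Arg z - t) + cmod z ^ 2) * trig_poly N a b t)
    has_integral a 0 * (2 * pi * (cmod z ^ 0 * cos (real 0 * Arg z - 0))) +
      (\<Sum>n=1..N. a n * (2 * pi * (cmod z ^ n * cos (real n * Arg z - 0))) +
         b n * (2 * pi * (cmod z ^ n * cos (real n * Arg z - pi / 2))))) {0..2*pi}"
    by (rule has_integral_mult_trig_poly) (rule has_integral_poisson_kernel_cos, use assms in auto)
  from integral_unique[OF this] show ?thesis
    by (simp add: harmonic_ext_def trig_poly_def cos_diff sum_divide_distrib add_divide_distrib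
        sum.distrib mult_ac)
qed

text \<open>Writing the damped Fourier coefficients back as integrals of \<open>h\<close> collects
  them into the truncated kernel. In this form the sign of the kernel can be exploited.\<close>

lemma harmonic_ext_L2_proj:
  assumes int: "\<And>\<alpha> m. (\<lambda>t. h t * cos (\<alpha> - real m * t)) integrable_on {0..2*pi}"
    and z: "cmod z < 1"
  shows "((\<lambda>t. h t * poisson_sum N (cmod z) (Arg z - t)) has_integral
    2 * pi * harmonic_ext (L2_proj N h) z) {0..2*pi}"
proof -
  let ?r = "cmod z" and ?\<theta> = "Arg z"
  let ?I = "\<lambda>\<alpha> m. integral {0..2*pi} (\<lambda>t. h t * cos (\<alpha> - real m * t))"
  have I0: "?I 0 n = (if n = 0 then 2 * pi else pi) * fourier_cos h n" for n
    by (simp add: fourier_cos_def)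
  have I1: "?I (pi/2) n = pi * fourier_sin h n" for n
    by (simp add: fourier_sin_def cos_diff)
  have "((\<lambda>t. h t * poisson_sum N ?r (?\<theta> - t)) has_integral
    1 * ?I 0 0 + (\<Sum>n=1..N. (2 * ?r ^ n * cos (real n * ?\<theta>)) * ?I 0 n +
      (2 * ?r ^ n * sin (real n * ?\<theta>)) * ?I (pi/2) n)) {0..2*pi}"
    unfolding poisson_sum_eq_trig_poly
    by (rule has_integral_eq_rhs[OF has_integral_mult_trig_poly[OF integrable_integral[OF int]]])
       (auto intro!: sum.cong)
  moreover have "1 * ?I 0 0 + (\<Sum>n=1..N. (2 * ?r ^ n * cos (real n * ?\<theta>)) * ?I 0 n +
      (2 * ?r ^ n * sin (real n * ?\<theta>)) * ?I (pi/2) n) = 2 * pi * harmonic_ext (L2_proj N h) z"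
    unfolding L2_proj_eq_trig_poly[OF int] harmonic_ext_trig_poly[OF z] I0 I1
    by (simp add: trig_poly_def distrib_left sum_distrib_left) (auto intro!: sum.cong simp: algebra_simps)
  ultimately show ?thesis by simp
qed

section \<open>Remainder of the logarithm series\<close>

text \<open>Integration along the segment from 0 to \<open>w\<close>: the derivative of the
  left-hand expression is a finite geometric sum minus the full one, and this remainder has norm at
  most \<open>s ^ N / (1 - s)\<close>.\<close>

lemma norm_log_tail_le:
  assumes "cmod w < 1"
  shows "cmod ((\<Sum>n=1..N. w ^ n / of_nat n) + Ln (1 - w)) \<le> integral {0..cmod w} (\<lambda>s. s ^ N / (1 - s))"
proof -
  \<comment> \<open>The direction of the segment. Unlike \<open>w / cmod w\<close>, it has modulus 1
    also for \<open>w = 0\<close>.\<close>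
  define u where "u = cis (Arg w)"
  let ?r = "cmod w"
  have w: "w = of_real ?r * u"
    using rcis_cmod_Arg[of w] by (simp add: u_def rcis_def)
  have u: "cmod u = 1" by (simp add: u_def)
  have s: "cmod (of_real s * u) < 1" if "s \<in> {0..?r}" for s
    using that assms by (simp add: norm_mult u)
  \<comment> \<open>Along the segment the argument of \<open>Ln\<close> keeps a positive real part
    and so avoids the branch cut.\<close>
  have dom: "1 - of_real s * u \<notin> \<real>\<^sub>\<le>\<^sub>0" if "s \<in> {0..?r}" for s
  proof -
    have "Re (of_real s * u) < 1" using s[OF that] complex_Re_le_cmod le_less_trans by blast
    then show ?thesis by (auto simp: complex_nonpos_Reals_iff)
  qed
  have geom: "(\<Sum>n=1..N. of_real s ^ (n - 1) * u ^ n) - u / (1 - of_real s * u) =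
      - (u * (of_real s * u) ^ N / (1 - of_real s * u))" if "s \<in> {0..?r}" for s
  proof -
    have ne: "of_real s * u \<noteq> 1" using s[OF that] by auto
    have "(\<Sum>n=1..N. of_real s ^ (n - 1) * u ^ n) = (\<Sum>n<N. u * (of_real s * u) ^ n)"
      by (simp add: sum.atLeast1_atMost_eq power_mult_distrib mult_ac)
    also have "\<dots> = u * ((1 - (of_real s * u) ^ N) / (1 - of_real s * u))"
      by (simp only: sum_distrib_left[symmetric] sum_gp_strict) (use ne in auto)
    finally show ?thesis using ne by (simp add: divide_simps) (simp add: algebra_simps)
  qed
  define F where "F s = (\<Sum>n=1..N. (of_real s * u) ^ n / of_nat n) + Ln (1 - of_real s * u)" for s :: real
  define f where "f s = - (u * (of_real s * u) ^ N / (1 - of_real s * u))" for s :: real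
  have F': "(F has_vector_derivative f s) (at s within {0..?r})" if "s \<in> {0..?r}" for s
  proof -
    have pow: "((\<lambda>x. (x * u) ^ n / of_nat n) has_field_derivative x ^ (n - 1) * u ^ n) (at x)"
      if "n \<in> {1..N}" for n x
    proof -
      have "((\<lambda>x. (x * u) ^ n / of_nat n) has_field_derivative
          (of_nat n * (u * (x * u) ^ (n - Suc 0))) / of_nat n) (at x)"
        using that by (auto intro!: derivative_eq_intros)
      moreover have "u * (x * u) ^ (n - Suc 0) = x ^ (n - 1) * u ^ n"
        using that by (cases n) (simp_all add: power_mult_distrib)
      ultimately show ?thesis using that by simp
    qed
    have log: "((\<lambda>x. Ln (1 - x * u)) has_field_derivative - u / (1 - x * u)) (at x)"
      if "1 - x * u \<notin> \<real>\<^sub>\<le>\<^sub>0" for x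
      using that by (auto intro!: derivative_eq_intros simp: divide_inverse)
    have "((\<lambda>x. (\<Sum>n=1..N. (x * u) ^ n / of_nat n) + Ln (1 - x * u)) has_field_derivative
        (\<Sum>n=1..N. x ^ (n - 1) * u ^ n) + - u / (1 - x * u)) (at x)" if "1 - x * u \<notin> \<real>\<^sub>\<le>\<^sub>0" for x
      by (intro DERIV_add DERIV_sum pow log that)
    from has_vector_derivative_real_field[OF this[OF dom[OF that]]] show ?thesis
      unfolding F_def f_def geom[OF that, symmetric] by simp
  qed
  have "(f has_integral (F ?r - F 0)) {0..?r}"
    by (intro fundamental_theorem_of_calculus F') auto
  moreover have "F ?r = (\<Sum>n=1..N. w ^ n / of_nat n) + Ln (1 - w)"
    by (simp add: F_def flip: w)
  moreover have "F 0 = 0" by (simp add: F_def power_0_left)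
  ultimately have F: "(f has_integral ((\<Sum>n=1..N. w ^ n / of_nat n) + Ln (1 - w))) {0..?r}" by simp
  have g: "(\<lambda>s. s ^ N / (1 - s)) integrable_on {0..?r}"
    using assms by (intro integrable_continuous_interval continuous_intros) auto
  have "norm (integral {0..?r} f) \<le> integral {0..?r} (\<lambda>s. s ^ N / (1 - s))"
  proof (rule integral_norm_bound_integral[OF has_integral_integrable[OF F] g])
    fix s assume s': "s \<in> {0..?r}"
    have "1 - s \<le> cmod (1 - of_real s * u)"
      using norm_triangle_ineq2[of 1 "of_real s * u"] s' by (simp add: norm_mult u)
    then show "norm (f s) \<le> s ^ N / (1 - s)"
      using s' assms by (auto simp: f_def norm_mult norm_divide norm_power u intro!: frac_le)
  qed
  then show ?thesis using integral_unique[OF F] by simp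
qed

section \<open>The radius \<open>r_star\<close> and the error term\<close>

lemma r_star_less_1: "N \<ge> 1 \<Longrightarrow> r_star N < 1"
  by (simp add: r_star_def)

text \<open>Explains the choice of \<open>r_star\<close>. With \<open>M = N + 1\<close> and
  \<open>L = ln (2 * M)\<close>, the bound
  \<open>r\<^sup>2 \<le> 1 - 2 * L / M \<le> exp (- 2 * L / M)\<close> gives
  \<open>r ^ M \<le> 1 / (2 * M)\<close>, while \<open>1 - r\<close> is at least
  \<open>(1 - r\<^sup>2) / 2 \<ge> L / M \<ge> 1 / M\<close>.\<close>

lemma power_le_of_le_r_star:
  assumes r: "0 \<le> r" "r \<le> r_star N" and N: "N \<ge> 1"
  shows "2 * r ^ (N + 1) \<le> 1 - r"
proof -
  define M where "M = real (N + 1)"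
  define L where "L = ln (2 * M)"
  have M: "M \<ge> 2" using N by (simp add: M_def)
  have "exp 1 \<le> 2 * M" using exp_le M by linarith
  then have L: "L \<ge> 1" unfolding L_def using M by (subst ln_ge_iff) auto
  have rs: "r_star N = sqrt (1 - 2 * (L / M))" by (simp add: r_star_def L_def M_def add.commute)
  \<comment> \<open>Here \<open>sqrt\<close> is an odd function on all reals, so nonnegativity of
    its value yields nonnegativity of its argument.\<close>
  have "0 \<le> r_star N" using r by linarith
  then have arg: "0 \<le> 1 - 2 * (L / M)" unfolding rs by (simp only: real_sqrt_ge_0_iff)
  have "r\<^sup>2 \<le> (r_star N)\<^sup>2" using r by (intro power_mono) auto
  then have r2: "r\<^sup>2 \<le> 1 - 2 * (L / M)" unfolding rs using arg by simp
  also have "\<dots> \<le> exp (- (2 * (L / M)))" using exp_ge_add_one_self[of "- (2 * (L / M))"] by simp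
  finally have "(r\<^sup>2) ^ (N + 1) \<le> exp (- (2 * (L / M))) ^ (N + 1)" by (intro power_mono) auto
  also have "\<dots> = exp (- L) ^ 2"
    using M by (simp only: exp_of_nat_mult[symmetric]) (simp add: M_def field_simps)
  also have "exp (- L) = 1 / (2 * M)" using M by (simp add: L_def exp_minus field_simps)
  finally have "(r ^ (N + 1))\<^sup>2 \<le> (1 / (2 * M))\<^sup>2" by (simp only: power_mult[symmetric] mult.commute)
  then have "r ^ (N + 1) \<le> 1 / (2 * M)" by (rule power2_le_imp_le) (use M in auto)
  then have "2 * r ^ (N + 1) \<le> 1 / M" by (simp add: field_simps)
  also have "\<dots> \<le> L / M" using L M by (intro divide_right_mono) auto
  also have "\<dots> \<le> (1 - r\<^sup>2) / 2" using r2 by simp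
  also have "\<dots> \<le> 1 - r"
  proof -
    have "0 \<le> 1 - 2 * r + r\<^sup>2" using zero_le_power2[of "1 - r"] by (simp add: power2_diff)
    then show ?thesis by argo
  qed
  finally show ?thesis .
qed

lemma integrable_power_over:
  fixes r :: real
  assumes "r < 1"
  shows "(\<lambda>s. s ^ N / (1 - s)) integrable_on {0..r}"
  using assms by (intro integrable_continuous_interval continuous_intros) auto

lemma eps_nonneg: "r < 1 \<Longrightarrow> 0 \<le> eps N r"
  unfolding eps_def by (intro mult_nonneg_nonneg integral_nonneg integrable_power_over) auto

lemma eps_mono: "r \<le> r' \<Longrightarrow> r' < 1 \<Longrightarrow> eps N r \<le> eps N r'"
  unfolding eps_def by (intro mult_left_mono integral_subset_le integrable_power_over) auto

subsection \<open>The lens geometry and the arc \<open>\<Gamma>\<^sub>1\<close>\<close>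

context
  fixes \<theta>1 \<theta>2 :: real
  assumes ang: "0 < \<theta>1" "\<theta>1 < \<theta>2" "\<theta>2 < pi"
begin

lemma sin_pos: "0 < sin \<theta>1" "0 < sin \<theta>2"
  using ang by (auto intro!: sin_gt_zero)

text \<open>Removes the case distinction: \<open>sin \<theta>1 / tan \<theta>2\<close> is
  \<open>radius2 * cos \<theta>2\<close>, which vanishes at the right angle.\<close>

lemma centre2_eq: "centre2 \<theta>1 \<theta>2 = cos \<theta>1 - radius2 \<theta>1 \<theta>2 * cos \<theta>2"
proof (cases "\<theta>2 = pi / 2")
  case True
  show ?thesis unfolding centre2_def True by simp
qed (simp add: centre2_def radius2_def tan_def)

lemma radius2_sin: "radius2 \<theta>1 \<theta>2 * sin \<theta>2 = sin \<theta>1"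
  using sin_pos by (simp add: radius2_def)

lemma radius2_pos: "0 < radius2 \<theta>1 \<theta>2"
  using sin_pos by (simp add: radius2_def)

text \<open>The law of sines, with \<open>\<theta>2 - \<theta>1\<close> strictly between 0 and
  \<open>pi\<close>. The sign decides on which side of the common chord each arc lies.\<close>

lemma centre2_pos: "0 < centre2 \<theta>1 \<theta>2"
proof -
  have "centre2 \<theta>1 \<theta>2 = sin (\<theta>2 - \<theta>1) / sin \<theta>2"
    using sin_pos by (simp add: centre2_eq radius2_def sin_diff field_simps)
  moreover have "0 < sin (\<theta>2 - \<theta>1)" using ang by (intro sin_gt_zero) auto
  ultimately show ?thesis using sin_pos by simp
qed

text \<open>The law of cosines, expressing that \<open>cis \<theta>1\<close> lies on both
  circles.\<close>

lemma radius2_sq: "(radius2 \<theta>1 \<theta>2)\<^sup>2 = 1 - 2 * centre2 \<theta>1 \<theta>2 * cos \<theta>1 + (centre2 \<theta>1 \<theta>2)\<^sup>2"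
proof -
  let ?R = "radius2 \<theta>1 \<theta>2"
  have "?R\<^sup>2 = (?R * cos \<theta>2)\<^sup>2 + (?R * sin \<theta>2)\<^sup>2"
    by (simp add: power_mult_distrib flip: distrib_left)
  also have "\<dots> = (?R * cos \<theta>2)\<^sup>2 + 1 - (cos \<theta>1)\<^sup>2"
    by (simp add: radius2_sin sin_squared_eq)
  finally show ?thesis by (simp add: centre2_eq power2_eq_square algebra_simps)
qed

text \<open>On the unit circle the squared distance to the second centre is affine and decreasing in
  \<open>Re x\<close>, and equals the squared radius at \<open>Re x = cos \<theta>1\<close>.\<close>

lemma Gamma1_eq: "Gamma1 \<theta>1 \<theta>2 = {x. cmod x = 1 \<and> cos \<theta>1 < Re x}"
proof -
  let ?R = "radius2 \<theta>1 \<theta>2" and ?m = "centre2 \<theta>1 \<theta>2"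
  have "cmod (Complex ?m 0 - x) < ?R \<longleftrightarrow> cos \<theta>1 < Re x" if "cmod x = 1" for x
  proof -
    have "cmod (Complex ?m 0 - x) < ?R \<longleftrightarrow> (cmod (Complex ?m 0 - x))\<^sup>2 < ?R\<^sup>2"
      by (metis norm_ge_zero less_imp_le pos2 power_strict_mono power_less_imp_less_base radius2_pos)
    also have "(cmod (Complex ?m 0 - x))\<^sup>2 = ?m\<^sup>2 - 2 * ?m * Re x + (cmod x)\<^sup>2"
      unfolding cmod_power2 by (simp add: power2_eq_square algebra_simps)
    also have "\<dots> < ?R\<^sup>2 \<longleftrightarrow> ?m * cos \<theta>1 < ?m * Re x"
      unfolding radius2_sq using that by auto
    finally show ?thesis using centre2_pos by simp
  qed
  then show ?thesis
    by (auto simp: Gamma1_def B1_def B2_def dist_norm)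
qed

text \<open>On the second circle \<open>(cmod z)\<^sup>2\<close> is affine and increasing in
  \<open>Re z\<close>, with value 1 at \<open>cos \<theta>1\<close>.\<close>

lemma Gamma2D:
  assumes "z \<in> Gamma2 \<theta>1 \<theta>2"
  shows "cmod z < 1" "Re z < cos \<theta>1"
    "(Re z - centre2 \<theta>1 \<theta>2)\<^sup>2 + (Im z)\<^sup>2 = (radius2 \<theta>1 \<theta>2)\<^sup>2"
proof -
  let ?R = "radius2 \<theta>1 \<theta>2" and ?m = "centre2 \<theta>1 \<theta>2"
  show 1: "cmod z < 1" using assms by (simp add: Gamma2_def B1_def)
  have "cmod (z - Complex ?m 0) = ?R"
    using assms radius2_pos by (simp add: Gamma2_def B2_def dist_norm norm_minus_commute)
  then have "(cmod (z - Complex ?m 0))\<^sup>2 = ?R\<^sup>2" by simp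
  then show 2: "(Re z - ?m)\<^sup>2 + (Im z)\<^sup>2 = ?R\<^sup>2" unfolding cmod_power2 by simp
  have "(cmod z)\<^sup>2 < 1" using 1 by (simp add: power_less_one_iff abs_square_less_1)
  then have "?m * Re z < ?m * cos \<theta>1"
    using 2 unfolding cmod_power2 radius2_sq by (simp add: power2_eq_square algebra_simps)
  then show "Re z < cos \<theta>1" using centre2_pos by simp
qed

text \<open>The inscribed angle theorem: from every point of \<open>\<Gamma>\<^sub>2\<close> the chord between the two
  intersection points is seen under the angle \<open>\<theta>2\<close>.\<close>
lemma inscribed_angle:
  assumes "z \<in> Gamma2 \<theta>1 \<theta>2"
  obtains \<rho> where "0 < \<rho>" "cis \<theta>1 - z = of_real \<rho> * cis \<theta>2 * (cis (- \<theta>1) - z)"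
proof -
  let ?R = "radius2 \<theta>1 \<theta>2" and ?m = "centre2 \<theta>1 \<theta>2"
  note z = Gamma2D[OF assms]
  have p: "cis \<theta>1 = of_real ?m + of_real ?R * cis \<theta>2"
    by (simp add: complex_eq_iff centre2_eq radius2_sin)
  define q where "q = cis (- \<theta>1) - z"
  have q: "q \<noteq> 0" using z(2) by (auto simp: q_def complex_eq_iff)
  have cq: "cnj q = cis \<theta>1 - cnj z" by (simp add: q_def cis_cnj)
  \<comment> \<open>The direction of the quotient is that of the product with the conjugate.
    Relative to the centre, \<open>?w * cnj ?w = R\<^sup>2\<close> allows
    \<open>R * cis \<theta>2\<close> to be factored out, and what remains is real.\<close>
  have "(cis \<theta>1 - z) * cnj q = of_real (2 * ?R * (cos \<theta>1 - Re z)) * cis \<theta>2"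
  proof -
    let ?w = "z - of_real ?m"
    have w: "?w * cnj ?w = of_real (?R\<^sup>2)"
      using z(3) by (subst complex_mult_cnj) simp
    have ww: "?w + cnj ?w = of_real (2 * (Re z - ?m))" by (simp add: complex_eq_iff)
    have "(cis \<theta>1 - z) * cnj q = (of_real ?R * cis \<theta>2 - ?w) * (of_real ?R * cis \<theta>2 - cnj ?w)"
      unfolding cq p by (simp add: algebra_simps)
    also have "\<dots> = of_real ?R * of_real ?R * cis \<theta>2 * cis \<theta>2 - of_real ?R * cis \<theta>2 * (?w + cnj ?w) + ?w * cnj ?w"
      by (simp add: algebra_simps)
    also have "\<dots> = of_real ?R * cis \<theta>2 * (of_real ?R * (cis \<theta>2 + cis (- \<theta>2)) - of_real (2 * (Re z - ?m)))"
      unfolding w ww by (simp add: algebra_simps power2_eq_square cis_mult)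
    also have "cis \<theta>2 + cis (- \<theta>2) = of_real (2 * cos \<theta>2)" by (simp add: complex_eq_iff)
    also have "of_real ?R * of_real (2 * cos \<theta>2) - of_real (2 * (Re z - ?m)) = (of_real (2 * (cos \<theta>1 - Re z)) :: complex)"
      by (simp add: centre2_eq complex_eq_iff)
    finally show ?thesis by (simp add: mult_ac)
  qed
  then have "(cis \<theta>1 - z) * (cnj q * q) = of_real (2 * ?R * (cos \<theta>1 - Re z)) * cis \<theta>2 * q"
    by (simp add: mult_ac)
  also have "cnj q * q = of_real ((cmod q)\<^sup>2)" by (simp only: complex_norm_square mult.commute)
  finally have "cis \<theta>1 - z = of_real (2 * ?R * (cos \<theta>1 - Re z) / (cmod q)\<^sup>2) * cis \<theta>2 * q"
    using q by (simp add: field_simps)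
  moreover have "0 < 2 * ?R * (cos \<theta>1 - Re z) / (cmod q)\<^sup>2"
    using q z(2) radius2_pos by simp
  ultimately show ?thesis using that unfolding q_def by blast
qed

text \<open>The inscribed angle fixes the difference of arguments modulo \<open>2 * pi\<close>. Both
  logarithms are taken in the right half-plane, so the difference lies strictly between
  \<open>- pi\<close> and \<open>pi\<close>, as does \<open>\<theta>2 - 2 * \<theta>1\<close>; hence
  no multiple of \<open>2 * pi\<close> intervenes.\<close>

lemma Im_Ln_diff_Gamma2:
  assumes "z \<in> Gamma2 \<theta>1 \<theta>2"
  shows "Im (Ln (1 - z * cis (- \<theta>1))) - Im (Ln (1 - z * cis \<theta>1)) = \<theta>2 - 2 * \<theta>1"
proof -
  let ?A = "1 - z * cis (- \<theta>1)" and ?B = "1 - z * cis \<theta>1"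
  obtain \<rho> where \<rho>: "0 < \<rho>" "cis \<theta>1 - z = of_real \<rho> * cis \<theta>2 * (cis (- \<theta>1) - z)"
    using inscribed_angle[OF assms] by blast
  have Re: "0 < Re (1 - z * cis t)" for t
  proof -
    have "cmod (z * cis t) < 1" using Gamma2D(1)[OF assms] by (simp add: norm_mult)
    then show ?thesis using complex_Re_le_cmod[of "z * cis t"] by (simp del: times_complex.sel)
  qed
  have nz: "1 - z * cis t \<noteq> 0" for t using Re[of t] by (metis less_irrefl zero_complex.sel(1))
  have "?A = cis (- \<theta>1) * (cis \<theta>1 - z)" by (simp add: algebra_simps cis_mult)
  also have "\<dots> = of_real \<rho> * cis (\<theta>2 - 2 * \<theta>1) * (cis \<theta>1 * (cis (- \<theta>1) - z))"
  proof -
    have "cis (- \<theta>1) * cis \<theta>2 = cis (\<theta>2 - 2 * \<theta>1) * cis \<theta>1" by (simp add: cis_mult)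
    then show ?thesis unfolding \<rho>(2) by (metis (no_types, lifting) mult.assoc mult.left_commute)
  qed
  also have "cis \<theta>1 * (cis (- \<theta>1) - z) = ?B" by (simp add: algebra_simps cis_mult)
  finally have A: "?A = of_real \<rho> * cis (\<theta>2 - 2 * \<theta>1) * ?B" .
  let ?D = "Ln ?A - Ln ?B"
  let ?D' = "Complex (ln \<rho>) (\<theta>2 - 2 * \<theta>1)"
  have "exp ?D = ?A / ?B" using nz by (simp add: exp_diff)
  also have "\<dots> = of_real \<rho> * cis (\<theta>2 - 2 * \<theta>1)" using A nz[of \<theta>1] by (simp add: field_simps)
  also have "\<dots> = exp ?D'" using \<rho>(1) by (simp add: exp_eq_polar exp_of_real)
  finally have "Ln (exp ?D) = Ln (exp ?D')" by simp
  moreover have "Ln (exp ?D) = ?D"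
  proof (rule Ln_exp)
    have "\<bar>Im (Ln (1 - z * cis t))\<bar> < pi / 2" for t using Re by (rule Re_Ln_pos_lt_imp)
    from this[of \<theta>1] this[of "- \<theta>1"] show "- pi < Im ?D" "Im ?D \<le> pi"
      unfolding minus_complex.sel by linarith+
  qed
  moreover have "Ln (exp ?D') = ?D'" using ang by (intro Ln_exp) auto
  ultimately show ?thesis by (metis complex.sel(2) minus_complex.sel(2))
qed

section \<open>Zero extension from the arc and comparison with constant data\<close>

lemma zero_ext_Gamma1: "zero_ext (Gamma1 \<theta>1 \<theta>2) v t = (if cos \<theta>1 < cos t then v (cis t) else 0)"
  by (simp add: zero_ext_def Gamma1_eq)

lemma one_in_Gamma1: "1 \<in> Gamma1 \<theta>1 \<theta>2"
  using ang cos_monotone_0_pi[of 0 \<theta>1] by (simp add: Gamma1_eq)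

lemma compact_closure_Gamma1: "compact (closure (Gamma1 \<theta>1 \<theta>2))"
  by (intro iffD2[OF compact_closure] boundedI[of _ 1]) (auto simp: Gamma1_eq)

lemma bounded_on_Gamma1:
  fixes v :: "complex \<Rightarrow> real"
  assumes "continuous_on (closure (Gamma1 \<theta>1 \<theta>2)) v"
  shows "bdd_above ((\<lambda>x. \<bar>v x\<bar>) ` closure (Gamma1 \<theta>1 \<theta>2))"
  by (intro bounded_imp_bdd_above compact_imp_bounded compact_continuous_image
      continuous_intros assms compact_closure_Gamma1)

lemma abs_le_sup_norm_Gamma1:
  assumes "continuous_on (closure (Gamma1 \<theta>1 \<theta>2)) v" "x \<in> closure (Gamma1 \<theta>1 \<theta>2)"
  shows "\<bar>v x\<bar> \<le> sup_norm (closure (Gamma1 \<theta>1 \<theta>2)) v"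
  using cSUP_upper[OF assms(2) bounded_on_Gamma1[OF assms(1)]] assms(2) by (auto simp: sup_norm_def)

lemma abs_zero_ext_le:
  assumes "continuous_on (closure (Gamma1 \<theta>1 \<theta>2)) v"
  shows "\<bar>zero_ext (Gamma1 \<theta>1 \<theta>2) v t\<bar> \<le>
    sup_norm (closure (Gamma1 \<theta>1 \<theta>2)) v * zero_ext (Gamma1 \<theta>1 \<theta>2) (\<lambda>_. 1) t"
  using abs_le_sup_norm_Gamma1[OF assms] closure_subset by (auto simp: zero_ext_def)

text \<open>Measurability comes from continuity of \<open>v\<close> along the open set
  \<open>S\<close> of angles of the arc, boundedness from compactness of the closed arc; extension
  by 0 then reaches the full interval.\<close>

lemma integrable_zero_ext:
  assumes v: "continuous_on (closure (Gamma1 \<theta>1 \<theta>2)) v" and g: "continuous_on UNIV g"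
  shows "(\<lambda>t. zero_ext (Gamma1 \<theta>1 \<theta>2) v t * g t) integrable_on {0..2*pi}"
proof -
  let ?\<Gamma> = "Gamma1 \<theta>1 \<theta>2"
  define S where "S = {t. cos \<theta>1 < cos t}"
  have "open S" unfolding S_def by (intro open_Collect_less continuous_intros)
  then have S: "S \<inter> {0..2*pi} \<in> sets lebesgue" by (intro sets.Int) (auto simp: borel_open)
  have lm: "S \<inter> {0..2*pi} \<in> lmeasurable"
    using S by (intro bounded_set_imp_lmeasurable bounded_Int) auto
  have "bounded (g ` {0..2*pi})"
    by (intro compact_imp_bounded compact_continuous_image continuous_on_subset[OF g]) auto
  then obtain C where C: "\<And>t. t \<in> {0..2*pi} \<Longrightarrow> \<bar>g t\<bar> \<le> C"
    unfolding bounded_iff by fastforce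
  have "(\<lambda>t. v (cis t) * g t) integrable_on S \<inter> {0..2*pi}"
  proof (rule measurable_bounded_by_integrable_imp_integrable)
    have "continuous_on S (\<lambda>t. v (cis t))"
    proof (rule continuous_on_compose2[OF v])
      show "continuous_on S cis" by (intro continuous_intros)
      show "cis ` S \<subseteq> closure ?\<Gamma>"
        using closure_subset[of ?\<Gamma>] by (auto simp: S_def Gamma1_eq)
    qed
    then have "continuous_on (S \<inter> {0..2*pi}) (\<lambda>t. v (cis t) * g t)"
      by (intro continuous_on_mult) (auto intro: continuous_on_subset continuous_on_subset[OF g])
    then show "(\<lambda>t. v (cis t) * g t) \<in> borel_measurable (lebesgue_on (S \<inter> {0..2*pi}))"
      using S by (rule continuous_imp_measurable_on_sets_lebesgue)
    show "(\<lambda>_. sup_norm (closure ?\<Gamma>) v * C) integrable_on S \<inter> {0..2*pi}"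
      using lm by (rule integrable_on_const)
    fix t assume t: "t \<in> S \<inter> {0..2*pi}"
    then have "cis t \<in> closure ?\<Gamma>"
      using closure_subset[of ?\<Gamma>] by (auto simp: S_def Gamma1_eq)
    then have "\<bar>v (cis t)\<bar> * \<bar>g t\<bar> \<le> sup_norm (closure ?\<Gamma>) v * C"
      using t C abs_le_sup_norm_Gamma1[OF v]
      by (intro mult_mono) (auto intro: order_trans[OF abs_ge_zero])
    then show "norm (v (cis t) * g t) \<le> sup_norm (closure ?\<Gamma>) v * C" by (simp add: abs_mult)
  qed (use S in auto)
  then have "(\<lambda>t. if t \<in> S then v (cis t) * g t else 0) integrable_on {0..2*pi}"
    by (simp only: integrable_restrict_Int)
  then show ?thesis
    by (rule integrable_eq) (simp add: S_def zero_ext_Gamma1)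
qed

lemma harmonic_ext_L2_proj_zero_ext:
  assumes "continuous_on (closure (Gamma1 \<theta>1 \<theta>2)) v" "cmod z < 1"
  shows "((\<lambda>t. zero_ext (Gamma1 \<theta>1 \<theta>2) v t * poisson_sum N (cmod z) (Arg z - t)) has_integral
    2 * pi * harmonic_ext (L2_proj N (zero_ext (Gamma1 \<theta>1 \<theta>2) v)) z) {0..2*pi}"
  by (intro harmonic_ext_L2_proj integrable_zero_ext assms continuous_intros)

text \<open>A nonnegative kernel preserves the pointwise domination of the data by a multiple of the
  indicator of the arc.\<close>

lemma harmonic_ext_le_sup_norm:
  assumes v: "continuous_on (closure (Gamma1 \<theta>1 \<theta>2)) v" and z: "cmod z < 1" "2 * cmod z ^ (N + 1) \<le> 1 - cmod z"
  shows "\<bar>harmonic_ext (L2_proj N (zero_ext (Gamma1 \<theta>1 \<theta>2) v)) z\<bar> \<le>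
    sup_norm (closure (Gamma1 \<theta>1 \<theta>2)) v * harmonic_ext (L2_proj N (zero_ext (Gamma1 \<theta>1 \<theta>2) (\<lambda>_. 1))) z"
proof -
  let ?K = "\<lambda>t. poisson_sum N (cmod z) (Arg z - t)"
  let ?s = "sup_norm (closure (Gamma1 \<theta>1 \<theta>2)) v"
  let ?h = "zero_ext (Gamma1 \<theta>1 \<theta>2)"
  let ?u = "\<lambda>v. harmonic_ext (L2_proj N (?h v)) z"
  note f = harmonic_ext_L2_proj_zero_ext[OF v z(1), of N]
  have g: "((\<lambda>t. ?s * (?h (\<lambda>_. 1) t * ?K t)) has_integral ?s * (2 * pi * ?u (\<lambda>_. 1))) {0..2*pi}"
    by (intro has_integral_mult_right harmonic_ext_L2_proj_zero_ext continuous_on_const z(1))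
  have "norm (integral {0..2*pi} (\<lambda>t. ?h v t * ?K t)) \<le> integral {0..2*pi} (\<lambda>t. ?s * (?h (\<lambda>_. 1) t * ?K t))"
  proof (rule integral_norm_bound_integral[OF has_integral_integrable[OF f] has_integral_integrable[OF g]])
    fix t
    have "0 \<le> ?K t" using z by (intro poisson_sum_nonneg) auto
    then show "norm (?h v t * ?K t) \<le> ?s * (?h (\<lambda>_. 1) t * ?K t)"
      using mult_right_mono[OF abs_zero_ext_le[OF v, of t], of "?K t"] by (simp add: abs_mult mult_ac)
  qed
  then show ?thesis
    unfolding integral_unique[OF f] integral_unique[OF g] by (simp add: abs_mult mult_ac)
qed

section \<open>The extension of the constant 1 on the arc\<close>

text \<open>In \<open>{0..2*pi}\<close> the arc appears as two end pieces. An explicit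
  antiderivative that grows by \<open>2 * pi\<close> per period joins them into one integral from
  \<open>- \<theta>1\<close> to \<open>\<theta>1\<close>.\<close>

lemma has_integral_poisson_sum_arc:
  fixes z :: complex and N :: nat
  defines "F \<equiv> \<lambda>w. \<Sum>n=1..N. w ^ n / of_nat n"
  shows "((\<lambda>t. zero_ext (Gamma1 \<theta>1 \<theta>2) (\<lambda>_. 1) t * poisson_sum N (cmod z) (Arg z - t)) has_integral
    2 * \<theta>1 + 2 * (Im (F (z * cis \<theta>1)) - Im (F (z * cis (- \<theta>1))))) {0..2*pi}"
proof -
  let ?r = "cmod z" and ?\<theta> = "Arg z"
  define f where "f = (\<lambda>t. zero_ext (Gamma1 \<theta>1 \<theta>2) (\<lambda>_. 1) t * poisson_sum N ?r (?\<theta> - t))"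
  \<comment> \<open>An antiderivative of the kernel in \<open>t\<close>; by \<open>ImF\<close> its
    sum is \<open>Im (F (z * cis (- t)))\<close>.\<close>
  define G where "G t = t - 2 * (\<Sum>n=1..N. ?r ^ n / real n * sin (real n * (?\<theta> - t)))" for t
  have G: "(G has_vector_derivative poisson_sum N ?r (?\<theta> - t)) (at t within S)" for t S
  proof -
    have "((\<lambda>t. ?r ^ n / real n * sin (real n * (?\<theta> - t))) has_real_derivative
        - (?r ^ n * cos (real n * (?\<theta> - t)))) (at t within S)" if "n \<in> {1..N}" for n
      using that by (auto intro!: derivative_eq_intros)
    then have "(G has_real_derivative 1 - 2 * (\<Sum>n=1..N. - (?r ^ n * cos (real n * (?\<theta> - t))))) (at t within S)"
      unfolding G_def by (intro DERIV_diff DERIV_ident DERIV_cmult DERIV_sum)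
    then show ?thesis
      by (simp add: poisson_sum_def sum_negf has_real_derivative_iff_has_vector_derivative)
  qed
  have int: "(poisson_sum N ?r \<circ> (\<lambda>t. ?\<theta> - t) has_integral G b - G a) {a..b}" if "a \<le> b" for a b
    unfolding o_def by (intro fundamental_theorem_of_calculus that G)
  have G_period: "G (2 * pi + t) = G t + 2 * pi" for t
  proof -
    have "sin (real n * (?\<theta> - (2 * pi + t))) = sin (real n * (?\<theta> - t))" for n
    proof -
      have "real n * (?\<theta> - (2 * pi + t)) = real n * (?\<theta> - t) - 2 * pi * real n"
        by (simp add: algebra_simps)
      then show ?thesis using sin_int_2pin[of "int n"] cos_int_2pin[of "int n"] by (simp only: sin_diff) simp
    qed
    then show ?thesis by (simp add: G_def)
  qed
  have ImF: "Im (F (z * cis s)) = (\<Sum>n=1..N. ?r ^ n / real n * sin (real n * (?\<theta> + s)))" for s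
  proof -
    have "z * cis s = of_real ?r * cis (?\<theta> + s)"
      by (subst rcis_cmod_Arg[of z, symmetric]) (simp add: rcis_def cis_mult mult.assoc)
    then have "(z * cis s) ^ n / of_nat n = of_real (?r ^ n / real n) * cis (real n * (?\<theta> + s))" for n
      by (simp add: power_mult_distrib Complex.DeMoivre)
    then have "Im ((z * cis s) ^ n / of_nat n) = ?r ^ n / real n * sin (real n * (?\<theta> + s))" for n
      by (simp only: times_complex.sel cis.sel Re_complex_of_real Im_complex_of_real mult_zero_left add_0_right)
    then show ?thesis by (simp only: F_def Im_sum)
  qed
  have 1: "(f has_integral G \<theta>1 - G 0) {0..\<theta>1}"
  \<comment> \<open>At the endpoint \<open>\<theta>1\<close> the zero extension vanishes, so the two
    integrands are compared only off this point.\<close>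
  proof (rule has_integral_spike_finite[OF _ _ int])
    fix t assume "t \<in> {0..\<theta>1} - {\<theta>1}"
    then show "f t = (poisson_sum N ?r \<circ> (\<lambda>t. ?\<theta> - t)) t"
      using ang cos_monotone_0_pi[of t \<theta>1] by (simp add: f_def zero_ext_Gamma1)
  qed (use ang in auto)
  have 2: "(f has_integral 0) {\<theta>1..2*pi - \<theta>1}"
  proof (rule has_integral_is_0)
    fix t assume t: "t \<in> {\<theta>1..2*pi - \<theta>1}"
    have "cos t \<le> cos \<theta>1"
    proof (cases "t \<le> pi")
      case True
      then show ?thesis using t ang by (intro cos_monotone_0_pi_le) auto
    next
      case False
      then have "cos (2 * pi - t) \<le> cos \<theta>1" using t ang by (intro cos_monotone_0_pi_le) auto
      then show ?thesis by simp
    qed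
    then show "f t = 0" by (simp add: f_def zero_ext_Gamma1)
  qed
  have 3: "(f has_integral G (2*pi) - G (2*pi - \<theta>1)) {2*pi - \<theta>1..2*pi}"
  proof (rule has_integral_spike_finite[OF _ _ int])
    fix t assume "t \<in> {2*pi - \<theta>1..2*pi} - {2*pi - \<theta>1}"
    then show "f t = (poisson_sum N ?r \<circ> (\<lambda>t. ?\<theta> - t)) t"
      using ang cos_monotone_0_pi[of "2 * pi - t" \<theta>1] by (simp add: f_def zero_ext_Gamma1)
  qed (use ang in auto)
  have "(f has_integral G \<theta>1 - G 0 + 0 + (G (2*pi) - G (2*pi - \<theta>1))) {0..2*pi}"
    using ang by (intro has_integral_combine[OF _ _ has_integral_combine[OF _ _ 1 2] 3]) auto
  also have "G \<theta>1 - G 0 + 0 + (G (2*pi) - G (2*pi - \<theta>1)) = G \<theta>1 - G (- \<theta>1)"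
    using G_period[of 0] G_period[of "- \<theta>1"] by simp
  also have "\<dots> = 2 * \<theta>1 + 2 * (Im (F (z * cis \<theta>1)) - Im (F (z * cis (- \<theta>1))))"
    unfolding ImF by (simp add: G_def)
  finally show ?thesis unfolding f_def .
qed

lemma harmonic_ext_one_le:
  assumes z: "z \<in> Gamma2 \<theta>1 \<theta>2"
  shows "harmonic_ext (L2_proj N (zero_ext (Gamma1 \<theta>1 \<theta>2) (\<lambda>_. 1))) z \<le> (\<theta>2 - \<theta>1) / pi + eps N (cmod z)"
proof -
  note z1 = Gamma2D(1)[OF z]
  let ?u = "harmonic_ext (L2_proj N (zero_ext (Gamma1 \<theta>1 \<theta>2) (\<lambda>_. 1))) z"
  let ?F = "\<lambda>w :: complex. \<Sum>n=1..N. w ^ n / of_nat n"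
  let ?I = "integral {0..cmod z} (\<lambda>s. s ^ N / (1 - s))"
  have tail: "\<bar>Im (?F (z * cis s)) + Im (Ln (1 - z * cis s))\<bar> \<le> ?I" for s
    using norm_log_tail_le[of "z * cis s" N] z1 abs_Im_le_cmod[of "?F (z * cis s) + Ln (1 - z * cis s)"]
    by (simp add: norm_mult)
  have "2 * pi * ?u = 2 * \<theta>1 + 2 * (Im (?F (z * cis \<theta>1)) - Im (?F (z * cis (- \<theta>1))))"
    by (rule has_integral_unique[OF harmonic_ext_L2_proj_zero_ext[OF continuous_on_const z1]
          has_integral_poisson_sum_arc])
  \<comment> \<open>Replacing both sums by logarithms costs \<open>?I\<close> each, and the
    logarithms contribute \<open>\<theta>2 - 2 * \<theta>1\<close>. Division by
    \<open>2 * pi\<close> turns \<open>4 * ?I\<close> into \<open>eps\<close>.\<close>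
  also have "\<dots> \<le> 2 * (\<theta>2 - \<theta>1) + 4 * ?I"
  proof -
    have "2 * \<theta>1 + 2 * (a - b) \<le> 2 * (\<theta>2 - \<theta>1) + 4 * e"
      if "a + c \<le> e" "- (b + d) \<le> e" "d - c = \<theta>2 - 2 * \<theta>1" for a b c d e :: real
      using that by argo
    from this[OF abs_le_D1[OF tail] abs_le_D2[OF tail] Im_Ln_diff_Gamma2[OF z]] show ?thesis .
  qed
  finally have "?u \<le> (\<theta>2 - \<theta>1 + 2 * ?I) / pi" by (simp add: pos_le_divide_eq mult.commute)
  then show ?thesis by (simp add: eps_def add_divide_distrib)
qed

end

section \<open>The maximum and its bound\<close>

theorem theorem5p4:
  fixes \<theta>1 \<theta>2 :: real and N :: nat
  assumes "0 < \<theta>1" and "\<theta>1 < \<theta>2" and "\<theta>2 < pi" and "N \<ge> 4"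
  shows "\<exists>v\<in>nonzero_cont \<theta>1 \<theta>2.
           (\<forall>w\<in>nonzero_cont \<theta>1 \<theta>2. ratio \<theta>1 \<theta>2 N w \<le> ratio \<theta>1 \<theta>2 N v) \<and>
           ratio \<theta>1 \<theta>2 N v \<le> (\<theta>2 - \<theta>1) / pi + eps N (r_star N)"
proof -
  note ang = assms(1-3)
  have N: "N \<ge> 1" using assms by simp
  let ?C = "closure (Gamma1 \<theta>1 \<theta>2)"
  let ?T = "Gamma2_trunc \<theta>1 \<theta>2 N"
  let ?b = "(\<theta>2 - \<theta>1) / pi + eps N (r_star N)"
  define u where "u v = harmonic_ext (L2_proj N (zero_ext (Gamma1 \<theta>1 \<theta>2) v))" for v
  \<comment> \<open>The maximizer; having norm 1, its ratio is the norm of its extension.\<close>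
  define one where "one = (\<lambda>_ :: complex. 1 :: real)"
  have C1: "1 \<in> ?C" using one_in_Gamma1[OF ang] closure_subset by blast
  have one: "one \<in> nonzero_cont \<theta>1 \<theta>2"
    using C1 by (auto simp: nonzero_cont_def one_def)
  have sup_one: "sup_norm ?C one = 1"
    using C1 by (auto simp: sup_norm_def one_def)
  have u_le: "\<bar>u v z\<bar> \<le> sup_norm ?C v * u one z"
    if "continuous_on ?C v" "z \<in> ?T" for v z
  proof -
    from that(2) have z: "z \<in> Gamma2 \<theta>1 \<theta>2" "cmod z \<le> r_star N"
      by (auto simp: Gamma2_trunc_def)
    show ?thesis
      unfolding u_def one_def using z N
      by (intro harmonic_ext_le_sup_norm ang that Gamma2D[OF ang] power_le_of_le_r_star) auto
  qed
  have u_one: "\<bar>u one z\<bar> \<le> ?b" if "z \<in> ?T" for z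
  proof -
    from that have z: "z \<in> Gamma2 \<theta>1 \<theta>2" "cmod z \<le> r_star N"
      by (auto simp: Gamma2_trunc_def)
    have "u one z \<le> (\<theta>2 - \<theta>1) / pi + eps N (cmod z)"
      unfolding u_def one_def by (rule harmonic_ext_one_le[OF ang z(1)])
    also have "\<dots> \<le> ?b" using eps_mono[OF z(2) r_star_less_1[OF N]] by simp
    \<comment> \<open>Taking \<open>v = one\<close> in \<open>u_le\<close> gives
      \<open>\<bar>u one z\<bar> \<le> u one z\<close>, so the one-sided bound is enough.\<close>
    finally show ?thesis
      using u_le[of one z] that by (simp add: sup_one) (simp add: one_def)
  qed
  have ratio_one: "ratio \<theta>1 \<theta>2 N one = sup_norm ?T (u one)"
    by (simp add: ratio_def sup_one u_def)
  \<comment> \<open>For empty \<open>?T\<close> the norm is 0 by convention, and nonnegativity of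
    \<open>?b\<close> is needed.\<close>
  have "sup_norm ?T (u one) \<le> ?b"
    using u_one eps_nonneg[OF r_star_less_1[OF N], of N] ang
    by (auto simp: sup_norm_def intro!: cSUP_least)
  moreover have "ratio \<theta>1 \<theta>2 N w \<le> ratio \<theta>1 \<theta>2 N one" if w: "w \<in> nonzero_cont \<theta>1 \<theta>2" for w
  proof -
    from w obtain x where x: "x \<in> ?C" "w x \<noteq> 0" and cont: "continuous_on ?C w"
      by (auto simp: nonzero_cont_def)
    have pos: "0 < sup_norm ?C w"
      using abs_le_sup_norm_Gamma1[OF ang cont x(1)] x(2) by linarith
    have "sup_norm ?T (u w) \<le> sup_norm ?C w * sup_norm ?T (u one)"
    proof (cases "?T = {}")
      case False
      have "\<bar>u w z\<bar> \<le> sup_norm ?C w * sup_norm ?T (u one)" if z: "z \<in> ?T" for z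
      proof -
        have "bdd_above ((\<lambda>z. \<bar>u one z\<bar>) ` ?T)" using u_one by (auto intro!: bdd_aboveI)
        from cSUP_upper[OF z this] have "u one z \<le> sup_norm ?T (u one)"
          using False by (simp add: sup_norm_def)
        then show ?thesis
          using pos by (intro order_trans[OF u_le[OF cont z]] mult_left_mono) auto
      qed
      then show ?thesis using False by (simp add: sup_norm_def cSUP_least)
    qed (simp add: sup_norm_def)
    then show ?thesis
      unfolding ratio_one using pos by (simp add: ratio_def u_def pos_divide_le_eq mult.commute)
  qed
  ultimately show ?thesis using one by (intro bexI[of _ one]) (simp_all add: ratio_one)
qed

end
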